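(* Let $N\in\mathbb Z^+$, $\lambda\in\mathbb C^*$, $X=\{(x_1,\dots,x_N)\in\mathbb C^N:x_1\cdots x_N=\lambda\}$, $\omega=\omega_{\mathbb C^N}|_X$, and let $(\mathcal Z,\omega_{\mathcal Z})$ be the symplectic manifold determined by the cutting configuration on $(X,\omega)$ induced by the standard $(S^1)^N_\bullet$-action, with submanifolds $X_i\subset\mathcal Z$ and maps $\pi$, $F$, $\phi_{\mathcal Z}$, $\mu_{\mathcal Z}$ (all as described in the context). Let $(S^1)^N_\lambda=\{(e^{\mathfrak i\theta_j})_{j\in[N]}\in(S^1)^N:\prod_je^{\mathfrak i\theta_j}=\lambda/|\lambda|\}$. There is a natural smooth map $$\check F:(S^1)^N_\lambda\times\mathbb C^N\to\mathcal Z$$ such that $\check F_g:(\mathbb C^N,\omega_{\mathbb C^N})\to(\mathcal Z,\omega_{\mathcal Z})$, $z\mapsto\check F(g,z)$, is a symplectomorphism for every $g\in(S^1)^N_\lambda$, and $$\check F\big((S^1)^N_\lambda\times\mathbb C^N_i\big)=X_i\ \ \forall i\in[N],\qquad \pi(\check F(g,z))=z_1\cdots z_N,\qquad \check F|_{(S^1)^N_\lambda\times X}=F|_{\{|\lambda|\}\times(S^1)^N_\lambda\times X},$$ $$\phi_{\mathcal Z}\big(g';\check F(g,z)\big)=\check F\big(g,\phi_{\mathbb C^N}(g';z)\big),\qquad \mu_{\mathcal Z}\big(\check F(g,z)\big)=r_\bullet\big(\mu_{\mathbb C^N}(z)\big)$$ for all $g\in(S^1)^N_\lambda$, $z\in\mathbb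 C^N$, $g'\in(S^1)^N_\bullet$, where $\mathbb C^N_i=\{z\in\mathbb C^N:z_i=0\}$.
   Context: $[N]=\{1,\dots,N\}$, $\omega_{\mathbb C^N}=\sum_kdx_k\wedge dy_k$. $(S^1)^N_\bullet=\{(e^{\mathfrak i\theta_i})\in(S^1)^N:\prod_ie^{\mathfrak i\theta_i}=1\}$, whose Lie algebra has dual $\mathfrak t^*_{N;\bullet}=\mathbb R^N/\mathbb R(1,\dots,1)$; $r_\bullet:\mathbb R^N\to\mathfrak t_{N;\bullet}^*$ is the quotient map. The standard $(S^1)^N$-action on $\mathbb C^N$ is $\phi_{\mathbb C^N}((e^{\mathfrak i\theta_i})_i;(z_i)_i)=(e^{\mathfrak i\theta_i}z_i)_i$, with moment map $\mu_{\mathbb C^N}((z_i)_i)=\frac12(|z_i|^2)_i$. The subgroup $(S^1)^N_\bullet$ preserves $X$; let $\phi=\phi_{\mathbb C^N}|_{(S^1)^N_\bullet\times X}$ and $\mu=r_\bullet\circ\mu_{\mathbb C^N}|_X$. The associated construction is: $$\widetilde{\mathcal Z}=\Big\{(x,z)\in X\times\mathbb C^N:\ |x_i|^2-|z_i|^2=|x_j|^2-|z_j|^2\ \forall i,j\in[N]\Big\},\qquad\mathcal Z=\widetilde{\mathcal Z}/(S^1)^N_\bullet,$$ with the free action $g\cdot(x,z)=(\phi_{\mathbb C^N}(g;x),\phi_{\mathbb C^N}(g^{-1};z))$; $q:\widetilde{\mathcal Z}\to\mathcal Z$, $q(x,z)=[x,z]$, is the quotient map, and $\omega_{\mathcal Z}$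 is the symplectic form with $q^*\omega_{\mathcal Z}=(\pi_1^*\omega_{\mathbb C^N}+\pi_2^*\omega_{\mathbb C^N})|_{\widetilde{\mathcal Z}}$. Further: - $X_i=\{[x,z]\in\mathcal Z:z_i=0\}$; - $\pi:\mathcal Z\to\mathbb C$, $\pi([x,z])=\prod_{i\in[N]}z_i$; - $\phi_{\mathcal Z}:(S^1)^N_\bullet\times\mathcal Z\to\mathcal Z$, $\phi_{\mathcal Z}(g;[x,z])=[\phi_{\mathbb C^N}(g;x),z]$, and $\mu_{\mathcal Z}:\mathcal Z\to\mathfrak t^*_{N;\bullet}$, $\mu_{\mathcal Z}([x,z])=r_\bullet(\mu_{\mathbb C^N}(x))$; - $F:\mathbb R^{\ge0}\times(S^1)^N\times X\to\mathcal Z$, $F(r,(e^{\mathfrak i\theta_j})_j,x)=\big[x,\big(e^{\mathfrak i\theta_j}\sqrt{|x_j|^2-|x_i|^2+\varrho}\,\big)_{j\in[N]}\big]$, where $i\in[N]$ is any fixed index (the result does not depend on it) and $\varrho$ is the unique solution of $\prod_{j\in[N]}(|x_j|^2-|x_i|^2+\varrho)=r^2$ with $\varrho\ge\max_j(|x_i|^2-|x_j|^2)$. *)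

theory Defs
  imports "HOL-Analysis.Analysis"
begin

section \<open>Smooth maps on open sets and on subsets of normed spaces\<close>

text \<open>
  The predicate Ck_on is meant for open sets: f is k times continuously
  differentiable, in terms of iterated directional derivatives.
\<close>

fun Ck_on :: "nat \<Rightarrow> ('a::real_normed_vector \<Rightarrow> 'b::real_normed_vector) \<Rightarrow> 'a set \<Rightarrow> bool" where
  "Ck_on 0 f U \<longleftrightarrow> continuous_on U f"
| "Ck_on (Suc k) f U \<longleftrightarrow> (\<forall>x\<in>U. f differentiable (at x)) \<and>
     (\<forall>v. Ck_on k (\<lambda>x. frechet_derivative f (at x) v) U)"

definition smooth_on :: "'a set \<Rightarrow> ('a::real_normed_vector \<Rightarrow> 'b::real_normed_vector) \<Rightarrow> bool" where
  "smooth_on U f \<longleftrightarrow> (\<forall>k. Ck_on k f U)"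

text \<open>
  For an arbitrary subset S: local existence of smooth extensions to the ambient space.  If S is
  an embedded submanifold, this is smoothness with respect to its manifold structure.
\<close>

definition smooth_on_subset :: "'a set \<Rightarrow> ('a::real_normed_vector \<Rightarrow> 'b::real_normed_vector) \<Rightarrow> bool" where
  "smooth_on_subset S f \<longleftrightarrow>
     (\<forall>p\<in>S. \<exists>W g. open W \<and> p \<in> W \<and> smooth_on W g \<and> (\<forall>x\<in>W \<inter> S. g x = f x))"

text \<open>
  Tangent vectors of an embedded submanifold S at p are the velocities at time 0 of the
  smooth curves in S through p.
\<close>

definition smooth_curve_at :: "'a::real_normed_vector set \<Rightarrow> 'a \<Rightarrow> (real \<Rightarrow> 'a) \<Rightarrow> bool" where
  "smooth_curve_at S p \<gamma> \<longleftrightarrow>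
     \<gamma> 0 = p \<and> (\<exists>\<epsilon>>0. smooth_on {-\<epsilon><..<\<epsilon>} \<gamma> \<and> \<gamma> ` {-\<epsilon><..<\<epsilon>} \<subseteq> S)"

definition velocity :: "(real \<Rightarrow> 'a::real_normed_vector) \<Rightarrow> 'a" where
  "velocity \<gamma> = vector_derivative \<gamma> (at 0)"


section \<open>Quotient manifolds, smooth maps and differential two-forms\<close>

text \<open>
  A chart (U, \<phi>) of a manifold modelled on a normed space; only the values of \<phi> on U matter.
\<close>

type_synonym ('m, 'e) chart = "'m set \<times> ('m \<Rightarrow> 'e)"

text \<open>
  The maximal atlas of the quotient of an embedded submanifold S by a map q, that is, of the
  smooth structure on the image of q for which q is a smooth submersion.  The domain U is open in
  the quotient topology, and the composite of \<phi> and q is a smooth submersion onto an open set whose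
  fibers are those of q.  As submersions are open and have smooth local sections, any such \<phi> is a
  homeomorphism onto its image and any two such charts are smoothly compatible.
\<close>

definition quotient_atlas ::
    "'a::real_normed_vector set \<Rightarrow> ('a \<Rightarrow> 'm) \<Rightarrow> ('m, 'e::real_normed_vector) chart set" where
  "quotient_atlas S q = {(U, \<phi>).
     U \<subseteq> q ` S \<and> openin (top_of_set S) (S \<inter> q -` U) \<and>
     inj_on \<phi> U \<and> open (\<phi> ` U) \<and>
     smooth_on_subset (S \<inter> q -` U) (\<phi> \<circ> q) \<and>
     (\<forall>p\<in>S \<inter> q -` U. \<forall>v. \<exists>\<gamma>. smooth_curve_at S p \<gamma> \<and> velocity (\<phi> \<circ> q \<circ> \<gamma>) = v)}"

text \<open>
  A smooth map from an embedded submanifold S of a normed space to a manifold with atlas A.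
\<close>

definition smooth_map ::
    "'a::real_normed_vector set \<Rightarrow> ('m, 'e::real_normed_vector) chart set \<Rightarrow> ('a \<Rightarrow> 'm) \<Rightarrow> bool" where
  "smooth_map S A f \<longleftrightarrow>
     (\<forall>p\<in>S. \<exists>(U, \<phi>)\<in>A. \<exists>W. open W \<and> p \<in> W \<and> f ` (S \<inter> W) \<subseteq> U \<and>
        smooth_on_subset (S \<inter> W) (\<phi> \<circ> f))"

text \<open>
  A two-form on a manifold with atlas A is given by its local representatives:
  for a chart c = (U, \<phi>) and y in the image of \<phi>, the bilinear form on the model space is \<Omega> c y.
  Local representatives are related by pullback along the transition maps \<tau>.
\<close>

type_synonym ('m, 'e) two_form = "('m, 'e) chart \<Rightarrow> 'e \<Rightarrow> 'e \<Rightarrow> 'e \<Rightarrow> real"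

definition is_two_form ::
    "('m, 'e::real_normed_vector) chart set \<Rightarrow> ('m, 'e) two_form \<Rightarrow> bool" where
  "is_two_form A \<Omega> \<longleftrightarrow>
     (\<forall>(U, \<phi>)\<in>A.
        (\<forall>y\<in>\<phi> ` U. bilinear (\<Omega> (U, \<phi>) y) \<and> (\<forall>v. \<Omega> (U, \<phi>) y v v = 0)) \<and>
        (\<forall>v w. smooth_on (\<phi> ` U) (\<lambda>y. \<Omega> (U, \<phi>) y v w))) \<and>
     (\<forall>(U, \<phi>)\<in>A. \<forall>(U', \<phi>')\<in>A. \<forall>m\<in>U \<inter> U'. \<forall>v w.
        (let \<tau> = \<phi>' \<circ> inv_into U \<phi>; d\<tau> = frechet_derivative \<tau> (at (\<phi> m))
         in \<Omega> (U, \<phi>) (\<phi> m) v w = \<Omega> (U', \<phi>') (\<phi>' m) (d\<tau> v) (d\<tau> w)))"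

definition is_closed_two_form ::
    "('m, 'e::real_normed_vector) chart set \<Rightarrow> ('m, 'e) two_form \<Rightarrow> bool" where
  "is_closed_two_form A \<Omega> \<longleftrightarrow> is_two_form A \<Omega> \<and>
     (\<forall>(U, \<phi>)\<in>A. \<forall>y\<in>\<phi> ` U. \<forall>u v w.
        frechet_derivative (\<lambda>y. \<Omega> (U, \<phi>) y v w) (at y) u +
        frechet_derivative (\<lambda>y. \<Omega> (U, \<phi>) y w u) (at y) v +
        frechet_derivative (\<lambda>y. \<Omega> (U, \<phi>) y u v) (at y) w = 0)"

definition is_symplectic_form ::
    "('m, 'e::real_normed_vector) chart set \<Rightarrow> ('m, 'e) two_form \<Rightarrow> bool" where
  "is_symplectic_form A \<Omega> \<longleftrightarrow> is_closed_two_form A \<Omega> \<and>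
     (\<forall>(U, \<phi>)\<in>A. \<forall>y\<in>\<phi> ` U. \<forall>v. (\<forall>w. \<Omega> (U, \<phi>) y v w = 0) \<longrightarrow> v = 0)"

text \<open>
  The pullback of \<Omega> by the map f on the embedded submanifold S is the restriction to S of the
  (constant coefficient) two-form \<eta> on the ambient space.  Tangent vectors of S and their images
  under the differential of f are expressed by velocities of curves.
\<close>

definition pulls_back_to ::
    "'a::real_normed_vector set \<Rightarrow> ('a \<Rightarrow> 'm) \<Rightarrow> ('m, 'e::real_normed_vector) chart set
      \<Rightarrow> ('m, 'e) two_form \<Rightarrow> ('a \<Rightarrow> 'a \<Rightarrow> real) \<Rightarrow> bool" where
  "pulls_back_to S f A \<Omega> \<eta> \<longleftrightarrow>
     (\<forall>p\<in>S. \<forall>(U, \<phi>)\<in>A. f p \<in> U \<longrightarrow>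
        (\<forall>\<gamma> \<delta>. smooth_curve_at S p \<gamma> \<and> smooth_curve_at S p \<delta> \<longrightarrow>
           \<Omega> (U, \<phi>) (\<phi> (f p)) (velocity (\<phi> \<circ> f \<circ> \<gamma>)) (velocity (\<phi> \<circ> f \<circ> \<delta>))
             = \<eta> (velocity \<gamma>) (velocity \<delta>)))"

text \<open>
  Diffeomorphisms from the whole model space onto the manifold M with atlas A, and those which
  pull back \<Omega> to the (constant coefficient) two-form \<eta>.
\<close>

definition diffeo_onto ::
    "'m set \<Rightarrow> ('m, 'e::real_normed_vector) chart set \<Rightarrow> ('e \<Rightarrow> 'm) \<Rightarrow> bool" where
  "diffeo_onto M A f \<longleftrightarrow> bij_betw f UNIV M \<and> smooth_map UNIV A f \<and>
     (\<forall>m\<in>M. \<exists>(U, \<phi>)\<in>A. m \<in> U \<and> smooth_on (\<phi> ` U) (inv_into UNIV f \<circ> inv_into U \<phi>))"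

definition symplectomorphism_onto ::
    "'m set \<Rightarrow> ('m, 'e::real_normed_vector) chart set \<Rightarrow> ('m, 'e) two_form
      \<Rightarrow> ('e \<Rightarrow> 'e \<Rightarrow> real) \<Rightarrow> ('e \<Rightarrow> 'm) \<Rightarrow> bool" where
  "symplectomorphism_onto M A \<Omega> \<eta> f \<longleftrightarrow> diffeo_onto M A f \<and> pulls_back_to UNIV f A \<Omega> \<eta>"


section \<open>The torus action on complex N-space\<close>

definition omega_C :: "complex^'n \<Rightarrow> complex^'n \<Rightarrow> real" where
  "omega_C v w = (\<Sum>k\<in>UNIV. Re (v $ k) * Im (w $ k) - Im (v $ k) * Re (w $ k))"

text \<open>
  Elements of the torus are vectors of unit complex numbers.  For c = 1 this is the subgroup
  acting on the hypersurface X, for c = lam / |lam| it is its coset determined by lam.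
\<close>

definition torus_prod :: "complex \<Rightarrow> (complex^'n) set" where
  "torus_prod c = {g. (\<forall>j. cmod (g $ j) = 1) \<and> (\<Prod>j\<in>UNIV. g $ j) = c}"

definition torus_inv :: "complex^'n \<Rightarrow> complex^'n" where
  "torus_inv g = (\<chi> j. inverse (g $ j))"

definition phi_C :: "complex^'n \<Rightarrow> complex^'n \<Rightarrow> complex^'n" where
  "phi_C g z = (\<chi> j. g $ j * z $ j)"

definition mu_C :: "complex^'n \<Rightarrow> real^'n" where
  "mu_C z = (\<chi> j. (cmod (z $ j))\<^sup>2 / 2)"

text \<open>
  The quotient map from real N-space by the diagonal line; elements of the quotient are cosets.
\<close>

definition r_bullet :: "real^'n \<Rightarrow> (real^'n) set" where
  "r_bullet v = {v + t *\<^sub>R (\<chi> j. 1) | t. True}"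


section \<open>The cut space\<close>

definition hypersurface :: "complex \<Rightarrow> (complex^'n) set" where
  "hypersurface lam = {x. (\<Prod>j\<in>UNIV. x $ j) = lam}"

definition cut_pre :: "complex \<Rightarrow> ((complex^'n) \<times> (complex^'n)) set" where
  "cut_pre lam = {(x, z). x \<in> hypersurface lam \<and>
     (\<forall>i j. (cmod (x $ i))\<^sup>2 - (cmod (z $ i))\<^sup>2 = (cmod (x $ j))\<^sup>2 - (cmod (z $ j))\<^sup>2)}"

text \<open>The class [x, z] is the orbit of (x, z).\<close>

definition cut_q :: "(complex^'n) \<times> (complex^'n) \<Rightarrow> ((complex^'n) \<times> (complex^'n)) set" where
  "cut_q = (\<lambda>(x, z). (\<lambda>g. (phi_C g x, phi_C (torus_inv g) z)) ` torus_prod 1)"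

definition cut_space :: "complex \<Rightarrow> ((complex^'n) \<times> (complex^'n)) set set" where
  "cut_space lam = cut_q ` cut_pre lam"

definition cut_atlas ::
    "complex \<Rightarrow> (((complex^'n) \<times> (complex^'n)) set, complex^'n) chart set" where
  "cut_atlas lam = quotient_atlas (cut_pre lam) cut_q"

definition omega_CC :: "(complex^'n) \<times> (complex^'n) \<Rightarrow> (complex^'n) \<times> (complex^'n) \<Rightarrow> real" where
  "omega_CC v w = omega_C (fst v) (fst w) + omega_C (snd v) (snd w)"

definition is_cut_symplectic_form ::
    "complex \<Rightarrow> (((complex^'n) \<times> (complex^'n)) set, complex^'n) two_form \<Rightarrow> bool" where
  "is_cut_symplectic_form lam \<omega> \<longleftrightarrow>
     is_symplectic_form (cut_atlas lam) \<omega> \<and>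
     pulls_back_to (cut_pre lam) cut_q (cut_atlas lam) \<omega> omega_CC"

definition cut_divisor :: "complex \<Rightarrow> 'n \<Rightarrow> ((complex^'n) \<times> (complex^'n)) set set" where
  "cut_divisor lam i = {cut_q (x, z) | x z. (x, z) \<in> cut_pre lam \<and> z $ i = 0}"

text \<open>
  The map on orbits induced by an invariant map: its common value on the orbit.
\<close>

definition induced :: "('a \<Rightarrow> 'b) \<Rightarrow> 'a set \<Rightarrow> 'b" where
  "induced f m = the_elem (f ` m)"

definition pi_Z :: "((complex^'n) \<times> (complex^'n)) set \<Rightarrow> complex" where
  "pi_Z = induced (\<lambda>(x, z). \<Prod>j\<in>UNIV. z $ j)"

definition phi_Z ::
    "complex^'n \<Rightarrow> ((complex^'n) \<times> (complex^'n)) set \<Rightarrow> ((complex^'n) \<times> (complex^'n)) set" where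
  "phi_Z g = induced (\<lambda>(x, z). cut_q (phi_C g x, z))"

definition mu_Z :: "((complex^'n) \<times> (complex^'n)) set \<Rightarrow> (real^'n) set" where
  "mu_Z = induced (\<lambda>(x, z). r_bullet (mu_C x))"

definition cut_rho :: "'n \<Rightarrow> real \<Rightarrow> complex^'n \<Rightarrow> real" where
  "cut_rho i r x = (THE \<rho>.
     (\<Prod>j\<in>UNIV. (cmod (x $ j))\<^sup>2 - (cmod (x $ i))\<^sup>2 + \<rho>) = r\<^sup>2 \<and>
     Max (range (\<lambda>j. (cmod (x $ i))\<^sup>2 - (cmod (x $ j))\<^sup>2)) \<le> \<rho>)"

text \<open>The index i is the auxiliary fixed index; the value does not depend on it.\<close>

definition cut_F ::
    "'n \<Rightarrow> real \<Rightarrow> complex^'n \<Rightarrow> complex^'n \<Rightarrow> ((complex^'n) \<times> (complex^'n)) set" where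
  "cut_F i r g x = cut_q (x, \<chi> j. g $ j *
     complex_of_real (sqrt ((cmod (x $ j))\<^sup>2 - (cmod (x $ i))\<^sup>2 + cut_rho i r x)))"


subsection \<open>The induced maps take the expected values on classes\<close>

lemma torus_prod_one_mem: "(\<chi> j. 1) \<in> torus_prod 1"
  by (simp add: torus_prod_def)

lemma torus_prod_mult:
  "g \<in> torus_prod 1 \<Longrightarrow> h \<in> torus_prod 1 \<Longrightarrow> phi_C g h \<in> torus_prod 1"
  by (simp add: torus_prod_def phi_C_def norm_mult prod.distrib)

lemma torus_prod_inv: "g \<in> torus_prod 1 \<Longrightarrow> torus_inv g \<in> torus_prod 1"
  using prod_inversef[of "($) g" UNIV] by (simp add: torus_prod_def torus_inv_def norm_inverse o_def)

lemma induced_cut_q: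
  assumes "\<And>g. g \<in> torus_prod 1 \<Longrightarrow> f (phi_C g x, phi_C (torus_inv g) z) = f (x, z)"
  shows "induced f (cut_q (x, z)) = f (x, z)"
proof -
  have "f ` cut_q (x, z) = {f (x, z)}"
    using assms torus_prod_one_mem by (auto simp: cut_q_def image_image)
  then show ?thesis by (simp add: induced_def)
qed

lemma pi_Z_cut_q: "pi_Z (cut_q (x, z)) = (\<Prod>j\<in>UNIV. z $ j)"
  unfolding pi_Z_def
  by (subst induced_cut_q)
     (use torus_prod_inv in \<open>auto simp: phi_C_def prod.distrib torus_prod_def\<close>)

lemma mu_Z_cut_q: "mu_Z (cut_q (x, z)) = r_bullet (mu_C x)"
  unfolding mu_Z_def
  by (subst induced_cut_q) (auto simp: phi_C_def mu_C_def torus_prod_def norm_mult)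

lemma cut_q_act:
  fixes g x z :: "complex^'n"
  assumes g: "g \<in> torus_prod 1"
  shows "cut_q (phi_C g x, phi_C (torus_inv g) z) = cut_q (x, z)"
proof -
  have nz: "g $ j \<noteq> 0" for j using g unfolding torus_prod_def
    by (metis (mono_tags, lifting) mem_Collect_eq norm_zero zero_neq_one)
  have 1: "phi_C h (phi_C g x) = phi_C (phi_C h g) x"
    "phi_C (torus_inv h) (phi_C (torus_inv g) z) = phi_C (torus_inv (phi_C h g)) z" for h :: "complex^'n"
    by (auto simp: phi_C_def torus_inv_def vec_eq_iff)
  have 2: "(\<lambda>h. phi_C h g) ` torus_prod 1 = torus_prod 1"
  proof (intro equalityI subsetI)
    fix h :: "complex^'n" assume "h \<in> torus_prod 1"
    then have "phi_C h (torus_inv g) \<in> torus_prod 1"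
      using g by (simp add: torus_prod_mult torus_prod_inv)
    moreover have "h = phi_C (phi_C h (torus_inv g)) g"
      using nz by (simp add: phi_C_def torus_inv_def vec_eq_iff)
    ultimately show "h \<in> (\<lambda>h. phi_C h g) ` torus_prod 1" by blast
  qed (use g torus_prod_mult in auto)
  have "cut_q (phi_C g x, phi_C (torus_inv g) z)
      = (\<lambda>h. (phi_C h x, phi_C (torus_inv h) z)) ` (\<lambda>h. phi_C h g) ` torus_prod 1"
    by (simp add: cut_q_def 1 image_image)
  then show ?thesis by (simp add: 2 cut_q_def)
qed

lemma phi_Z_cut_q: "phi_Z g (cut_q (x, z)) = cut_q (phi_C g x, z)"
proof -
  have "phi_C g (phi_C h x) = phi_C h (phi_C g x)" for h
    by (simp add: phi_C_def vec_eq_iff)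
  then show ?thesis
    unfolding phi_Z_def by (subst induced_cut_q) (auto simp: cut_q_act)
qed

end

theory Submission
  imports Defs
begin

text \<open>
  Put $\check F_g(z) = [(g_j \sqrt{|z_j|^2 + t})_j, z]$, where $t = t(z)$ is the unique real number for
  which all $|z_j|^2 + t$ are positive with product $|\lambda|^2$; it depends smoothly on $z$ by the
  implicit function theorem.  The inverse $[x, z] \mapsto (z_j x_j / (g_j |x_j|))_j$ is well defined
  on all of the cut space, as no $x_j$ vanishes, and is a global chart of it.  The form pulls back
  correctly since the first component of the lift $z \mapsto ((g_j \sqrt{|z_j|^2 + t})_j, z)$
  takes values in a Lagrangian subspace (fixed phases).
\<close>


section \<open>Calculus of $C^k$ maps\<close>

text \<open>On the level set the differences |x_j|^2 - |z_j|^2 have a common value t, and the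
  subgroup can rotate the phases of x to any prescribed g whose product is the phase of lam. The
  moduli of x are then determined by z and t. The equation prod x_j = lam splits into a condition on
  g, which gives the coset, and a condition on t, which is where |lam|^2 comes from. So the lift is
  a global slice meeting every orbit once, and the inverse coordinate is z after that rotation. The
  technical obstacle is regularity: smoothness is \<open>Ck_on\<close> for all k, that is, iterated
  directional derivatives. Closure rules therefore go by induction on k, and the implicit function
  needs an explicit derivative formula to feed such an induction. Dependence on g is then easy: in
  the chart of a fixed g0 the point over (g, z) has coordinates z_j g_j / g0_j, from which t has
  cancelled.\<close>

lemma Ck_on_cong:
  assumes "open U" "Ck_on k f U" "\<And>x. x \<in> U \<Longrightarrow> f x = g x"
  shows "Ck_on k g U"
  using assms(2,3)
proof (induction k arbitrary: f g)
  case 0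
  then show ?case using continuous_on_cong by fastforce
next
  case (Suc k)
  have d: "f differentiable at x" if "x \<in> U" for x using Suc.prems(1) that by simp
  have eq: "frechet_derivative f (at x) = frechet_derivative g (at x)" if "x \<in> U" for x
    using frechet_derivative_transform_within_open[OF d \<open>open U\<close>] that Suc.prems(2) by blast
  have "g differentiable at x" if "x \<in> U" for x
    using d[OF that] has_derivative_transform_within_open[OF _ \<open>open U\<close> that] Suc.prems(2)
    unfolding differentiable_def by blast
  moreover have "Ck_on k (\<lambda>x. frechet_derivative g (at x) v) U" for v
    by (rule Suc.IH[of "\<lambda>x. frechet_derivative f (at x) v"]) (use Suc.prems(1) eq in auto)
  ultimately show ?case by simp
qed

text \<open>Lets the derivative be supplied as an explicit formula, so that a closure rule at level
  k + 1 reduces to level k rules applied to that formula.\<close>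

lemma Ck_on_SucI:
  assumes "open U" "\<And>x. x \<in> U \<Longrightarrow> (f has_derivative f' x) (at x)"
    and "\<And>v. Ck_on k (\<lambda>x. f' x v) U"
  shows "Ck_on (Suc k) f U"
proof -
  have "f' x = frechet_derivative f (at x)" if "x \<in> U" for x
    using frechet_derivative_at[OF assms(2)[OF that]] .
  then have "Ck_on k (\<lambda>x. frechet_derivative f (at x) v) U" for v
    by (intro Ck_on_cong[OF \<open>open U\<close> assms(3)[of v]]) simp
  then show ?thesis using assms(2) by (auto simp: differentiable_def)
qed

lemma Ck_on_Suc_has_derivative:
  "Ck_on (Suc k) f U \<Longrightarrow> x \<in> U \<Longrightarrow> (f has_derivative frechet_derivative f (at x)) (at x)"
  using frechet_derivative_works by auto

lemma Ck_on_SucD: "Ck_on (Suc k) f U \<Longrightarrow> Ck_on k f U"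
proof (induction k arbitrary: f)
  case 0
  then show ?case
    by (auto intro!: continuous_at_imp_continuous_on differentiable_imp_continuous_within)
next
  case (Suc k)
  then show ?case by (metis Ck_on.simps(2))
qed

lemma Ck_on_const: "open U \<Longrightarrow> Ck_on k (\<lambda>x. c) U"
proof (induction k arbitrary: c)
  case (Suc k)
  show ?case
    by (rule Ck_on_SucI[where f' = "\<lambda>x v. 0"]) (use Suc in auto)
qed simp

lemma Ck_on_bounded_linear:
  assumes "bounded_linear L" "open U"
  shows "Ck_on k f U \<Longrightarrow> Ck_on k (\<lambda>x. L (f x)) U"
proof (induction k arbitrary: f)
  case 0
  then show ?case using bounded_linear.continuous_on[OF assms(1)] by simp
next
  case (Suc k)
  show ?case
  proof (rule Ck_on_SucI[OF assms(2)])
    show "((\<lambda>x. L (f x)) has_derivative (\<lambda>v. L (frechet_derivative f (at x) v))) (at x)"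
      if "x \<in> U" for x
      by (rule bounded_linear.has_derivative[OF assms(1) Ck_on_Suc_has_derivative[OF Suc.prems that]])
    show "Ck_on k (\<lambda>x. L (frechet_derivative f (at x) v)) U" for v
      using Suc by simp
  qed
qed

lemma Ck_on_ident: "open U \<Longrightarrow> Ck_on k (\<lambda>x. x) U"
proof (cases k)
  case (Suc m)
  assume "open U"
  then show ?thesis unfolding Suc
    by (intro Ck_on_SucI[where f' = "\<lambda>x v. v"] Ck_on_const) auto
qed simp

lemma Ck_on_add:
  assumes "open U"
  shows "Ck_on k f U \<Longrightarrow> Ck_on k g U \<Longrightarrow> Ck_on k (\<lambda>x. f x + g x) U"
proof (induction k arbitrary: f g)
  case (Suc k)
  show ?case
  proof (rule Ck_on_SucI[OF assms])
    show "((\<lambda>x. f x + g x) has_derivative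
        (\<lambda>v. frechet_derivative f (at x) v + frechet_derivative g (at x) v)) (at x)" if "x \<in> U" for x
      by (intro has_derivative_add Ck_on_Suc_has_derivative[OF Suc.prems(1) that]
          Ck_on_Suc_has_derivative[OF Suc.prems(2) that])
  qed (use Suc in simp)
qed (simp add: continuous_on_add)

lemma Ck_on_sum:
  assumes "open U" "\<And>i. i \<in> I \<Longrightarrow> Ck_on k (f i) U"
  shows "Ck_on k (\<lambda>x. \<Sum>i\<in>I. f i x) U"
  using assms(2)
  by (induction I rule: infinite_finite_induct) (simp_all add: Ck_on_const Ck_on_add assms(1))

text \<open>Leibniz rule; the undifferentiated factor in each summand is demoted to class k by
  \<open>Ck_on_SucD\<close>.\<close>

lemma Ck_on_bounded_bilinear:
  assumes B: "bounded_bilinear B" and U: "open U"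
  shows "Ck_on k f U \<Longrightarrow> Ck_on k g U \<Longrightarrow> Ck_on k (\<lambda>x. B (f x) (g x)) U"
proof (induction k arbitrary: f g)
  case 0
  then show ?case using bounded_bilinear.continuous_on[OF B] by simp
next
  case (Suc k)
  show ?case
  proof (rule Ck_on_SucI[OF U])
    show "((\<lambda>x. B (f x) (g x)) has_derivative
        (\<lambda>v. B (f x) (frechet_derivative g (at x) v) + B (frechet_derivative f (at x) v) (g x))) (at x)"
      if "x \<in> U" for x
      by (rule bounded_bilinear.FDERIV[OF B Ck_on_Suc_has_derivative[OF Suc.prems(1) that]
          Ck_on_Suc_has_derivative[OF Suc.prems(2) that]])
    show "Ck_on k (\<lambda>x. B (f x) (frechet_derivative g (at x) v) +
        B (frechet_derivative f (at x) v) (g x)) U" for v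
      using Suc.prems Suc.prems[THEN Ck_on_SucD] by (intro Ck_on_add[OF U] Suc.IH) auto
  qed
qed

lemmas Ck_on_mult = Ck_on_bounded_bilinear[OF bounded_bilinear_mult]
lemmas Ck_on_scaleR = Ck_on_bounded_bilinear[OF bounded_bilinear_scaleR]
lemmas Ck_on_inner = Ck_on_bounded_bilinear[OF bounded_bilinear_inner]

lemma Ck_on_prod:
  fixes f :: "'i \<Rightarrow> 'a::real_normed_vector \<Rightarrow> 'b::{real_normed_algebra,comm_ring_1}"
  assumes "open U" "\<And>i. i \<in> I \<Longrightarrow> Ck_on k (f i) U"
  shows "Ck_on k (\<lambda>x. \<Prod>i\<in>I. f i x) U"
  using assms(2)
proof (induction I rule: infinite_finite_induct)
  case (insert i I)
  then have "Ck_on k (\<lambda>x. f i x * (\<Prod>i\<in>I. f i x)) U"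
    by (intro Ck_on_mult assms(1)) auto
  then show ?case by (simp only: prod.insert[OF insert(1,2)])
qed (simp_all add: Ck_on_const assms(1))

lemma Ck_on_Pair:
  assumes "open U" "Ck_on k f U" "Ck_on k g U"
  shows "Ck_on k (\<lambda>x. (f x, g x)) U"
proof -
  have 1: "bounded_linear (\<lambda>u. (u, 0))" and 2: "bounded_linear (\<lambda>u. (0, u))"
    by (simp_all add: bounded_linear_Pair bounded_linear_ident bounded_linear_zero)
  have "Ck_on k (\<lambda>x. (f x, 0) + (0, g x)) U"
    by (intro Ck_on_add assms(1) Ck_on_bounded_linear[OF 1] Ck_on_bounded_linear[OF 2] assms(2,3))
  then show ?thesis by simp
qed

lemma bounded_linear_axis: "bounded_linear (axis i :: 'a::real_normed_vector \<Rightarrow> 'a^'n)"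
proof (rule bounded_linear_intro[where K = 1])
  show "axis i (x + y) = axis i x + (axis i y :: 'a^'n)" for x y
    by (simp add: axis_def vec_eq_iff)
  show "axis i (r *\<^sub>R x) = r *\<^sub>R (axis i x :: 'a^'n)" for r x
    by (simp add: axis_def vec_eq_iff)
  show "norm (axis i x :: 'a^'n) \<le> norm x * 1" for x
    by (simp add: norm_vec_def L2_set_def axis_def if_distrib if_distribR cong: if_cong)
qed

lemma Ck_on_vec_lambda:
  fixes f :: "'n::finite \<Rightarrow> 'a::real_normed_vector \<Rightarrow> 'b::real_normed_vector"
  assumes "open U" "\<And>i. Ck_on k (f i) U"
  shows "Ck_on k (\<lambda>x. \<chi> i. f i x) U"
proof -
  have "Ck_on k (\<lambda>x. \<Sum>i\<in>UNIV. axis i (f i x) :: 'b^'n) U"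
    by (intro Ck_on_sum assms Ck_on_bounded_linear[OF bounded_linear_axis])
  moreover have "(\<Sum>i\<in>UNIV. axis i (c i)) = (\<chi> i. c i)" for c :: "'n \<Rightarrow> 'b"
    by (simp add: vec_eq_iff axis_def if_distrib cong: if_cong)
  ultimately show ?thesis by simp
qed

text \<open>The chain rule evaluates the derivative of g in a direction that moves with x, whereas
  \<open>Ck_on\<close> speaks about fixed directions only. Expanding the direction in a basis
  separates the two dependences, hence the Euclidean space in the middle.\<close>

lemma Ck_on_compose:
  fixes f :: "'a::real_normed_vector \<Rightarrow> 'b::euclidean_space"
  assumes U: "open U" and V: "open V" and "f ` U \<subseteq> V"
  shows "Ck_on k g V \<Longrightarrow> Ck_on k f U \<Longrightarrow> Ck_on k (\<lambda>x. g (f x)) U"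
proof (induction k arbitrary: g)
  case 0
  then show ?case using continuous_on_compose2 assms(3) by fastforce
next
  case (Suc k)
  let ?Df = "\<lambda>x. frechet_derivative f (at x)" and ?Dg = "\<lambda>x. frechet_derivative g (at x)"
  have df: "(f has_derivative ?Df x) (at x)" if "x \<in> U" for x
    using Ck_on_Suc_has_derivative[OF Suc.prems(2) that] .
  have dg: "(g has_derivative ?Dg (f x)) (at (f x))" if "x \<in> U" for x
    using Ck_on_Suc_has_derivative[OF Suc.prems(1)] assms(3) that by blast
  have expand: "?Dg (f x) w = (\<Sum>b\<in>Basis. (w \<bullet> b) *\<^sub>R ?Dg (f x) b)" if "x \<in> U" for x w
  proof -
    interpret bounded_linear "?Dg (f x)" using has_derivative_bounded_linear[OF dg[OF that]] .
    show ?thesis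
      by (subst (1) euclidean_representation[of w, symmetric]) (simp only: sum scaleR)
  qed
  show ?case
  proof (rule Ck_on_SucI[OF U])
    show "((\<lambda>x. g (f x)) has_derivative (\<lambda>v. ?Dg (f x) (?Df x v))) (at x)" if "x \<in> U" for x
      using has_derivative_compose[OF df dg] that by blast
    fix v
    have "Ck_on k (\<lambda>x. ?Dg (f x) b) U" for b
      using Suc.IH[of "\<lambda>y. ?Dg y b"] Suc.prems Ck_on_SucD by (metis Ck_on.simps(2))
    then have "Ck_on k (\<lambda>x. \<Sum>b\<in>Basis. (?Df x v \<bullet> b) *\<^sub>R ?Dg (f x) b) U"
      using Suc.prems
      by (intro Ck_on_sum Ck_on_scaleR Ck_on_inner Ck_on_const U) auto
    then show "Ck_on k (\<lambda>x. ?Dg (f x) (?Df x v)) U"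
      by (rule Ck_on_cong[OF U]) (use expand in simp)
  qed
qed

text \<open>The exponent is generalized because differentiation lowers it by one. Real powers serve
  below for square roots and for reciprocals of positive functions.\<close>

lemma Ck_on_powr_const: "Ck_on k (\<lambda>x::real. x powr a) {0<..}"
proof (induction k arbitrary: a)
  case 0
  show ?case by (auto intro!: continuous_intros)
next
  case (Suc k)
  show ?case
  proof (rule Ck_on_SucI)
    show "((\<lambda>x. x powr a) has_derivative (\<lambda>v. (a * x powr (a - 1)) * v)) (at x)"
      if "x \<in> {0<..}" for x :: real
      using has_real_derivative_powr[of x a] that by (simp add: has_field_derivative_def)
    show "Ck_on k (\<lambda>x. a * x powr (a - 1) * v) {0<..}" for v :: real
      by (intro Ck_on_mult Ck_on_const Suc) auto
  qed simp
qed

lemma Ck_on_powr: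
  assumes "open U" "Ck_on k f U" "\<And>x. x \<in> U \<Longrightarrow> 0 < f x"
  shows "Ck_on k (\<lambda>x. f x powr a :: real) U"
  by (rule Ck_on_compose[OF assms(1) _ _ Ck_on_powr_const assms(2)]) (use assms in auto)


section \<open>The shift normalizing a product\<close>

text \<open>As long as all factors stay positive, the product increases strictly with the shift;
  this is the uniqueness of t.\<close>

lemma prod_add_cancel:
  fixes a :: "'i \<Rightarrow> real"
  assumes "finite I" "I \<noteq> {}" "\<And>i. i \<in> I \<Longrightarrow> 0 < a i + s" "\<And>i. i \<in> I \<Longrightarrow> 0 < a i + t"
    and eq: "(\<Prod>i\<in>I. a i + s) = (\<Prod>i\<in>I. a i + t)"
  shows "s = t"
proof -
  obtain i where "i \<in> I" using assms(2) by blast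
  have "(\<Prod>i\<in>I. a i + s) < (\<Prod>i\<in>I. a i + t)"
    if "s < t" "\<And>i. i \<in> I \<Longrightarrow> 0 < a i + s" for s t
    by (rule prod_mono_strict[OF \<open>i \<in> I\<close>]) (use that assms(1) in \<open>force dest: that(2)\<close>)+
  then show ?thesis using assms(3,4) eq by (metis linorder_neq_iff order_less_irrefl)
qed

definition prod_shift :: "real \<Rightarrow> real^'n \<Rightarrow> real" where
  "prod_shift w a = (THE t. (\<forall>j. 0 < a $ j + t) \<and> (\<Prod>j\<in>UNIV. a $ j + t) = w)"

lemma prod_shift_eq:
  assumes "\<And>j. 0 < a $ j + t" "(\<Prod>j\<in>UNIV. a $ j + t) = w"
  shows "prod_shift w a = t"
  unfolding prod_shift_def
  by (rule the_equality) (use assms prod_add_cancel[of UNIV "($) a"] in auto)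

lemma prod_shift:
  fixes a :: "real^'n"
  assumes "0 < w"
  shows "0 < a $ j + prod_shift w a" "(\<Prod>j\<in>UNIV. a $ j + prod_shift w a) = w"
proof -
  define m where "m = Min (range (($) a))"
  have m: "m \<le> a $ j" for j by (simp add: m_def)
  have "m \<in> range (($) a)" unfolding m_def by (rule Min_in) auto
  then obtain i where i: "a $ i = m" by auto
  \<comment> \<open>At the shift \<open>M - m\<close> every factor is at least M, and M >= 1 gives w
    <= M <= M^N; at \<open>- m\<close> the factor of a minimal entry vanishes. The intermediate
    value theorem is applied between these two shifts.\<close>
  define M where "M = max 1 w"
  let ?P = "\<lambda>t. \<Prod>j\<in>UNIV. a $ j + t"
  have "?P (- m) = 0"
    by (rule prod_zero) (use i in auto)
  then have "?P (- m) \<le> w" using assms by linarith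
  moreover have "w \<le> ?P (M - m)"
  proof -
    have "w \<le> M ^ CARD('n)"
      using self_le_power[of M "CARD('n)"] by (simp add: M_def)
    also have "\<dots> = (\<Prod>j\<in>(UNIV::'n set). M)" by simp
    also have "\<dots> \<le> ?P (M - m)"
      by (rule prod_mono) (use m in \<open>auto simp: M_def algebra_simps\<close>)
    finally show ?thesis .
  qed
  moreover have "continuous_on {- m..M - m} ?P" by (intro continuous_intros)
  moreover have "- m \<le> M - m" by (simp add: M_def)
  ultimately obtain t where t: "- m \<le> t" "?P t = w"
    using IVT'[of ?P "- m" w "M - m"] by blast
  \<comment> \<open>The bound \<open>- m \<le> t\<close> only makes the factors nonnegative; none of
    them is zero because their product w is positive.\<close>
  have "0 < a $ j + t" for j
  proof -
    have "a $ j + t \<noteq> 0"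
      using t(2) assms prod_zero_iff[of UNIV "\<lambda>j. a $ j + t"] by (metis UNIV_I finite order_less_irrefl)
    then show ?thesis using m[of j] t(1) by simp
  qed
  with t(2) show "0 < a $ j + prod_shift w a" "?P (prod_shift w a) = w"
    using prod_shift_eq[of a t w] by auto
qed

text \<open>
  Inverse function theorem for $(a, t) \mapsto (a, \prod_j (a_j + t))$.
\<close>

lemma prod_shift_has_derivative:
  fixes a :: "real^'n"
  assumes w: "0 < w"
  defines "t \<equiv> prod_shift w a"
  defines "Q \<equiv> \<lambda>i. \<Prod>j\<in>UNIV - {i}. a $ j + t"
  shows "(prod_shift w has_derivative (\<lambda>v. - (\<Sum>i\<in>UNIV. v $ i * Q i) * (\<Sum>i\<in>UNIV. Q i) powr - 1)) (at a)"
proof -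
  let ?f = "\<lambda>(a :: real^'n, t). (a, \<Prod>j\<in>UNIV. a $ j + t)"
  let ?g = "\<lambda>(a :: real^'n, w). (a, prod_shift w a)"
  let ?f' = "\<lambda>(v :: real^'n, \<tau>). (v, \<Sum>i\<in>UNIV. (v $ i + \<tau>) * Q i)"
  let ?R = "\<Sum>i\<in>UNIV. Q i"
  \<comment> \<open>The reciprocal is written as a power so that \<open>Ck_on_powr\<close> applies
    to the derivative in the bootstrapping below.\<close>
  let ?g' = "\<lambda>(v :: real^'n, \<eta>). (v, (\<eta> - (\<Sum>i\<in>UNIV. v $ i * Q i)) * ?R powr - 1)"
  have pos: "0 < a $ j + t" and eq: "(\<Prod>j\<in>UNIV. a $ j + t) = w" for j
    using prod_shift[OF w] by (auto simp: t_def)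
  have "0 < Q i" for i unfolding Q_def by (rule prod_pos) (use pos in auto)
  then have R: "0 < ?R" by (intro sum_pos) auto
  have "(?g has_derivative ?g') (at (?f (a, t)))"
  \<comment> \<open>This version takes the inverse map as given: it suffices that \<open>?g\<close>
    is a left inverse of the continuous \<open>?f\<close> on an open set, and that the linear map
    \<open>?g'\<close> is a right inverse of the derivative at the one point.\<close>
  proof (rule has_derivative_inverse_strong[where S = "{p. \<forall>j. 0 < fst p $ j + snd p}" and f = ?f
        and f' = ?f' and x = "(a, t)"])
    show "open {p :: (real^'n) \<times> real. \<forall>j. 0 < fst p $ j + snd p}"
      unfolding Collect_all_eq by (intro open_INT ballI open_Collect_less continuous_intros) auto
    show "(a, t) \<in> {p. \<forall>j. 0 < fst p $ j + snd p}" using pos by simp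
    show "continuous_on {p. \<forall>j. 0 < fst p $ j + snd p} ?f"
      unfolding case_prod_beta by (intro continuous_intros)
    show "?g (?f p) = p" if "p \<in> {p. \<forall>j. 0 < fst p $ j + snd p}" for p
      using that prod_shift_eq[of "fst p" "snd p"] by (auto simp: case_prod_beta)
    show "(?f has_derivative ?f') (at (a, t))"
      unfolding case_prod_beta Q_def
      by (auto intro!: derivative_eq_intros bounded_linear.has_derivative[OF bounded_linear_vec_nth])
    show "?f' \<circ> ?g' = id"
    proof
      fix p :: "(real^'n) \<times> real"
      obtain v \<eta> where p: "p = (v, \<eta>)" by fastforce
      have "(\<Sum>i\<in>UNIV. (v $ i + \<tau>) * Q i) = (\<Sum>i\<in>UNIV. v $ i * Q i) + \<tau> * ?R" for \<tau>
        by (simp add: distrib_right sum.distrib sum_distrib_left)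
      moreover have "?R powr - 1 * ?R = 1" using R by (simp add: powr_minus)
      ultimately show "(?f' \<circ> ?g') p = id p"
        by (simp add: p mult.assoc)
    qed
  qed
  then have "(?g has_derivative ?g') (at (a, w))" by (simp add: eq)
  \<comment> \<open>Freezing the second argument at w leaves the derivative in a.\<close>
  then have "((\<lambda>x. snd (?g (x, w))) has_derivative (\<lambda>v. snd (?g' (v, 0)))) (at a)"
    by (intro has_derivative_snd has_derivative_compose[of "\<lambda>x. (x, w)" "\<lambda>v. (v, 0)" a UNIV ?g ?g'])
      (auto intro!: derivative_eq_intros)
  then show ?thesis by simp
qed

text \<open>
  Bootstrapping: the derivative is a smooth expression in the function itself.
\<close>

lemma Ck_on_prod_shift:
  assumes "0 < w"
  shows "Ck_on k (prod_shift w :: real^'n \<Rightarrow> real) UNIV"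
proof (induction k)
  case 0
  have "isCont (prod_shift w) a" for a :: "real^'n"
    using prod_shift_has_derivative[OF assms] has_derivative_continuous by blast
  then show ?case by (simp add: continuous_at_imp_continuous_on)
next
  case (Suc k)
  have pos: "0 < (\<Sum>i\<in>UNIV. \<Prod>j\<in>UNIV - {i}. a $ j + prod_shift w a)" for a :: "real^'n"
    by (intro sum_pos prod_pos ballI prod_shift(1) assms) auto
  have nth: "Ck_on k (\<lambda>a :: real^'n. a $ j) UNIV" for j
    by (intro Ck_on_bounded_linear[OF bounded_linear_vec_nth] Ck_on_ident open_UNIV)
  have fac: "Ck_on k (\<lambda>a :: real^'n. \<Prod>j\<in>I. a $ j + prod_shift w a) UNIV" for I
    by (intro Ck_on_prod Ck_on_add Suc nth open_UNIV)
  show ?case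
    unfolding mult_minus_left
    by (rule Ck_on_SucI[OF open_UNIV prod_shift_has_derivative[OF assms]])
      (intro Ck_on_mult Ck_on_powr Ck_on_sum Ck_on_const fac open_UNIV pos
        Ck_on_bounded_linear[OF bounded_linear_minus[OF bounded_linear_ident]])
qed


section \<open>Smooth curves and the lift to the level set\<close>

lemma Ck_on_cmod_power2:
  "open U \<Longrightarrow> Ck_on k f U \<Longrightarrow> Ck_on k (\<lambda>x. (cmod (f x))\<^sup>2) U"
  by (simp add: power2_norm_eq_inner Ck_on_inner)

lemma Ck_on_vec_nth: "open U \<Longrightarrow> Ck_on k f U \<Longrightarrow> Ck_on k (\<lambda>x. f x $ j) U"
  by (rule Ck_on_bounded_linear[OF bounded_linear_vec_nth])

lemma has_vector_derivative_smooth_curve: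
  assumes "smooth_curve_at S p \<gamma>"
  shows "(\<gamma> has_vector_derivative velocity \<gamma>) (at 0)"
proof -
  obtain \<epsilon> where "\<epsilon> > 0" "smooth_on {-\<epsilon><..<\<epsilon>} \<gamma>"
    using assms unfolding smooth_curve_at_def by blast
  then have "Ck_on (Suc 0) \<gamma> {-\<epsilon><..<\<epsilon>}" unfolding smooth_on_def by blast
  then have "\<gamma> differentiable (at 0)" using \<open>\<epsilon> > 0\<close> by simp
  then show ?thesis unfolding velocity_def by (rule vector_derivative_works[THEN iffD1])
qed

lemma velocity_compose:
  assumes "smooth_curve_at S p \<gamma>" "(f has_derivative D) (at p)"
  shows "velocity (f \<circ> \<gamma>) = D (velocity \<gamma>)"
proof -
  have "\<gamma> 0 = p" using assms(1) by (simp add: smooth_curve_at_def)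
  then have "(f \<circ> \<gamma> has_derivative (\<lambda>t. D (t *\<^sub>R velocity \<gamma>))) (at 0)"
    using diff_chain_at[of \<gamma> _ 0 f D] assms has_vector_derivative_smooth_curve[OF assms(1)]
    by (simp add: has_vector_derivative_def o_def)
  then have "(f \<circ> \<gamma> has_vector_derivative D (velocity \<gamma>)) (at 0)"
    using has_derivative_bounded_linear[OF assms(2)]
    by (simp add: has_vector_derivative_def bounded_linear.linear linear_cmul)
  then show ?thesis unfolding velocity_def by (rule vector_derivative_at)
qed

lemma smooth_curve_at_compose:
  fixes \<gamma> :: "real \<Rightarrow> 'a::euclidean_space"
  assumes "smooth_curve_at UNIV p \<gamma>" "smooth_on UNIV f" "range f \<subseteq> S"
  shows "smooth_curve_at S (f p) (f \<circ> \<gamma>)"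
proof -
  obtain \<epsilon> where "\<gamma> 0 = p" "\<epsilon> > 0" "smooth_on {-\<epsilon><..<\<epsilon>} \<gamma>"
    using assms unfolding smooth_curve_at_def by blast
  moreover from this have "smooth_on {-\<epsilon><..<\<epsilon>} (f \<circ> \<gamma>)"
    using assms(2) Ck_on_compose[of "{-\<epsilon><..<\<epsilon>}" UNIV \<gamma> _ f] unfolding smooth_on_def o_def by simp
  ultimately show ?thesis
    using assms(3) unfolding smooth_curve_at_def by auto
qed

lemma smooth_curve_at_line: "smooth_curve_at UNIV z (\<lambda>t. z + t *\<^sub>R v)"
  unfolding smooth_curve_at_def smooth_on_def
  by (auto intro!: exI[of _ 1] Ck_on_add Ck_on_scaleR Ck_on_const Ck_on_ident)

lemma velocity_line: "velocity (\<lambda>t. z + t *\<^sub>R v) = v"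
  unfolding velocity_def
  by (rule vector_derivative_at) (auto intro!: derivative_eq_intros)

section \<open>The orbit action, the lift, and the inverse coordinate\<close>

lemma torus_prodD:
  assumes "g \<in> torus_prod c"
  shows "cmod (g $ j) = 1" "g $ j \<noteq> 0" "(\<Prod>j\<in>UNIV. g $ j) = c"
proof -
  show "cmod (g $ j) = 1" "(\<Prod>j\<in>UNIV. g $ j) = c"
    using assms by (auto simp: torus_prod_def)
  then show "g $ j \<noteq> 0" by (metis norm_zero zero_neq_one)
qed

text \<open>The action whose orbits are the values of \<open>cut_q\<close>, as a linear self-map of
  pairs; by linearity it carries smooth lifts to smooth lifts.\<close>

definition torus_act ::
    "complex^'n \<Rightarrow> (complex^'n) \<times> (complex^'n) \<Rightarrow> (complex^'n) \<times> (complex^'n)" where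
  "torus_act h p = (phi_C h (fst p), phi_C (torus_inv h) (snd p))"

lemma bounded_linear_torus_act: "bounded_linear (torus_act h)"
  unfolding linear_conv_bounded_linear[symmetric]
  by (rule linearI) (auto simp: torus_act_def phi_C_def vec_eq_iff algebra_simps)

lemma cut_q_torus_act: "h \<in> torus_prod 1 \<Longrightarrow> cut_q (torus_act h p) = cut_q p"
  using cut_q_act[of h "fst p" "snd p"] by (simp add: torus_act_def)

lemma torus_act_cut_pre:
  assumes "h \<in> torus_prod 1" "p \<in> cut_pre lam"
  shows "torus_act h p \<in> cut_pre lam"
  using assms torus_prodD[OF assms(1)] unfolding torus_act_def cut_pre_def hypersurface_def
  by (auto simp: phi_C_def torus_inv_def norm_mult norm_inverse prod.distrib case_prod_beta)

definition phase_embed :: "complex^'n \<Rightarrow> real^'n \<Rightarrow> complex^'n" where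
  "phase_embed g s = (\<chi> j. g $ j * complex_of_real (s $ j))"

definition cut_radii :: "real \<Rightarrow> complex^'n \<Rightarrow> real^'n" where
  "cut_radii w z = (\<chi> j. sqrt ((cmod (z $ j))\<^sup>2 + prod_shift w (\<chi> j. (cmod (z $ j))\<^sup>2)))"

definition cut_section ::
    "real \<Rightarrow> complex^'n \<Rightarrow> complex^'n \<Rightarrow> (complex^'n) \<times> (complex^'n)" where
  "cut_section w g z = (phase_embed g (cut_radii w z), z)"

text \<open>The fraction is the rotation h_j taking g_j |x_j| to x_j. If (x, z) is the translate by
  h of a point of the lift over c, then z_j = c_j / h_j, so multiplying z_j by h_j recovers
  c_j.\<close>

definition cut_coord :: "complex^'n \<Rightarrow> (complex^'n) \<times> (complex^'n) \<Rightarrow> complex^'n" where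
  "cut_coord g p = (\<chi> j. snd p $ j * (fst p $ j / (g $ j * complex_of_real (cmod (fst p $ j)))))"

lemma bounded_linear_phase_embed: "bounded_linear (phase_embed g)"
  unfolding linear_conv_bounded_linear[symmetric]
  by (rule linearI) (simp_all add: phase_embed_def vec_eq_iff algebra_simps scaleR_conv_of_real[where 'a = complex])

lemma omega_C_phase_embed: "omega_C (phase_embed g s) (phase_embed g t) = 0"
  by (simp add: omega_C_def phase_embed_def)

lemma cut_radii_pos: "0 < w \<Longrightarrow> 0 < cut_radii w z $ j"
  using prod_shift(1)[of w "\<chi> j. (cmod (z $ j))\<^sup>2" j] by (simp add: cut_radii_def)

lemma cut_radii_power2:
  "0 < w \<Longrightarrow> (cut_radii w z $ j)\<^sup>2 = (cmod (z $ j))\<^sup>2 + prod_shift w (\<chi> j. (cmod (z $ j))\<^sup>2)"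
  using prod_shift(1)[of w "\<chi> j. (cmod (z $ j))\<^sup>2" j] by (simp add: cut_radii_def)

lemma prod_cut_radii:
  assumes "0 < w"
  shows "(\<Prod>j\<in>UNIV. cut_radii (w\<^sup>2) z $ j) = w"
proof (rule power2_eq_imp_eq)
  show "(\<Prod>j\<in>UNIV. cut_radii (w\<^sup>2) z $ j)\<^sup>2 = w\<^sup>2"
    using prod_shift(2)[of "w\<^sup>2" "\<chi> j. (cmod (z $ j))\<^sup>2"] assms
    by (simp add: cut_radii_power2 prod_power_distrib)
qed (use assms in \<open>auto intro!: prod_nonneg less_imp_le[OF cut_radii_pos]\<close>)

text \<open>Uniqueness of the shift, in the form that identifies the moduli of an arbitrary point of
  the level set.\<close>

lemma cut_radii_eq:
  fixes z :: "complex^'n"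
  assumes "\<And>j. 0 < s $ j" "(\<Prod>j\<in>UNIV. s $ j) = w" "\<And>j. (s $ j)\<^sup>2 = (cmod (z $ j))\<^sup>2 + t"
  shows "cut_radii (w\<^sup>2) z = s"
proof -
  have "s $ j \<noteq> 0" for j using assms(1)[of j] by simp
  then have "prod_shift (w\<^sup>2) (\<chi> j. (cmod (z $ j))\<^sup>2) = t"
    by (intro prod_shift_eq)
      (simp_all add: assms(2)[symmetric] prod_power_distrib flip: assms(3))
  then show ?thesis
    unfolding cut_radii_def by (simp add: vec_eq_iff assms(1) less_imp_le flip: assms(3))
qed

lemma Ck_on_cut_radii:
  assumes "0 < w"
  shows "Ck_on k (cut_radii w) UNIV"
proof -
  let ?N = "\<lambda>z :: complex^'n. \<chi> j. (cmod (z $ j))\<^sup>2"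
  have sq: "Ck_on k (\<lambda>z :: complex^'n. (cmod (z $ j))\<^sup>2) UNIV" for j
    by (intro Ck_on_cmod_power2 Ck_on_vec_nth Ck_on_ident open_UNIV)
  have sh: "Ck_on k (\<lambda>z. prod_shift w (?N z)) UNIV"
    by (rule Ck_on_compose[OF open_UNIV open_UNIV _ Ck_on_prod_shift[OF assms]])
      (auto intro!: Ck_on_vec_lambda sq)
  have pos: "0 < (cmod (z $ j))\<^sup>2 + prod_shift w (?N z)" for z :: "complex^'n" and j
    using prod_shift(1)[OF assms, of "?N z" j] by simp
  \<comment> \<open>The radicand is positive even where z_j = 0, so the square root is smooth there
    too; as a power 1/2 it is covered by \<open>Ck_on_powr\<close>.\<close>
  have "Ck_on k (\<lambda>z. \<chi> j. ((cmod (z $ j))\<^sup>2 + prod_shift w (?N z)) powr (1/2)) UNIV"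
    by (intro Ck_on_vec_lambda Ck_on_powr Ck_on_add sq sh open_UNIV pos)
  then show ?thesis
    by (rule Ck_on_cong[OF open_UNIV]) (simp only: cut_radii_def powr_half_sqrt[OF less_imp_le[OF pos]])
qed

lemma smooth_on_cut_section: "0 < w \<Longrightarrow> smooth_on UNIV (cut_section w g)"
  unfolding smooth_on_def cut_section_def
  by (intro allI Ck_on_Pair Ck_on_bounded_linear[OF bounded_linear_phase_embed] Ck_on_cut_radii
      Ck_on_ident open_UNIV)

lemma smooth_on_cut_coord:
  "smooth_on {p. \<forall>j. fst p $ j \<noteq> 0} (cut_coord g :: (complex^'n) \<times> (complex^'n) \<Rightarrow> _)"
  unfolding smooth_on_def
proof
  fix k
  let ?U = "{p :: (complex^'n) \<times> (complex^'n). \<forall>j. fst p $ j \<noteq> 0}"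
  have U: "open ?U"
    unfolding Collect_all_eq by (intro open_INT ballI open_Collect_neq continuous_intros) auto
  have fst: "Ck_on k (\<lambda>p. fst p $ j) ?U" and snd: "Ck_on k (\<lambda>p. snd p $ j) ?U" for j
    by (intro Ck_on_vec_nth U Ck_on_bounded_linear[OF bounded_linear_fst]
        Ck_on_bounded_linear[OF bounded_linear_snd] Ck_on_ident)+
  \<comment> \<open>Division by |x_j| becomes a real power of |x_j|^2, which is smooth everywhere
    and positive where x_j is nonzero.\<close>
  have "Ck_on k (\<lambda>p. \<chi> j. ((cmod (fst p $ j))\<^sup>2 powr (-1/2)) *\<^sub>R
      (snd p $ j * (fst p $ j * inverse (g $ j)))) ?U"
    by (intro Ck_on_vec_lambda U Ck_on_scaleR Ck_on_powr Ck_on_cmod_power2 Ck_on_mult Ck_on_const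
        fst snd) auto
  then show "Ck_on k (cut_coord g) ?U"
    by (rule Ck_on_cong[OF U])
      (auto simp: cut_coord_def vec_eq_iff powr_minus powr_half_sqrt scaleR_conv_of_real divide_simps)
qed

lemma cut_coord_torus_act: "h \<in> torus_prod 1 \<Longrightarrow> cut_coord g (torus_act h p) = cut_coord g p"
  using torus_prodD[of h 1]
  by (simp add: cut_coord_def torus_act_def phi_C_def torus_inv_def vec_eq_iff norm_mult field_simps)

text \<open>Two phase tuples are allowed so that the lifts for all g can be read in the coordinate
  of one fixed g'. The radii cancel, since only the phases of the first component enter.\<close>

lemma cut_coord_cut_section:
  assumes "0 < w" "g \<in> torus_prod c"
  shows "cut_coord g' (cut_section w g z) = (\<chi> j. z $ j * (g $ j * inverse (g' $ j)))"
proof -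
  have "\<bar>cut_radii w z $ j\<bar> = cut_radii w z $ j" "cut_radii w z $ j \<noteq> 0" for j
    using cut_radii_pos[OF assms(1), of z j] by auto
  then show ?thesis
    using torus_prodD(1)[OF assms(2)]
    by (simp add: cut_coord_def cut_section_def phase_embed_def vec_eq_iff norm_mult field_simps)
qed

lemma cut_coord_cut_section_same:
  assumes "0 < w" "g \<in> torus_prod c"
  shows "cut_coord g (cut_section w g z) = z"
  using torus_prodD[OF assms(2)] by (simp add: cut_coord_cut_section[OF assms] vec_eq_iff)


section \<open>The global chart of the cut space\<close>

definition cut_map :: "complex \<Rightarrow> complex^'n \<Rightarrow> complex^'n \<Rightarrow> ((complex^'n) \<times> (complex^'n)) set" where
  "cut_map lam g z = cut_q (cut_section ((cmod lam)\<^sup>2) g z)"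

definition cut_chart :: "complex^'n \<Rightarrow> ((complex^'n) \<times> (complex^'n)) set \<Rightarrow> complex^'n" where
  "cut_chart g = induced (cut_coord g)"

lemma cut_chart_cut_q: "cut_chart g (cut_q p) = cut_coord g p"
  using induced_cut_q[of "cut_coord g" "fst p" "snd p"] cut_coord_torus_act[of _ g p]
  by (simp add: cut_chart_def torus_act_def)

context
  fixes lam :: complex and g :: "complex^'n"
  assumes lam: "lam \<noteq> 0" and g: "g \<in> torus_prod (lam / complex_of_real (cmod lam))"
begin

lemma cut_section_cut_pre: "cut_section ((cmod lam)\<^sup>2) g z \<in> cut_pre lam"
proof -
  let ?r = "cut_radii ((cmod lam)\<^sup>2) z"
  have "(\<Prod>j\<in>UNIV. g $ j * complex_of_real (?r $ j)) = lam"
    using torus_prodD(3)[OF g] prod_cut_radii[of "cmod lam" z] lam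
    by (simp add: prod.distrib flip: of_real_prod)
  moreover have "cmod (g $ j * complex_of_real (?r $ j)) ^ 2
      = (cmod (z $ j))\<^sup>2 + prod_shift ((cmod lam)\<^sup>2) (\<chi> j. (cmod (z $ j))\<^sup>2)" for j
    using torus_prodD(1)[OF g] cut_radii_power2[of "(cmod lam)\<^sup>2" z j] lam
    by (simp add: norm_mult power_mult_distrib)
  ultimately show ?thesis
    by (simp add: cut_section_def phase_embed_def cut_pre_def hypersurface_def)
qed

lemma cut_chart_cut_map: "cut_chart g (cut_map lam g z) = z"
  using lam cut_coord_cut_section_same[OF _ g, of "(cmod lam)\<^sup>2"]
  by (simp add: cut_map_def cut_chart_cut_q)

text \<open>Every orbit meets the lift: dividing out the phases of x relative to g leaves g_j |x_j|
  in the first component, and \<open>cut_radii_eq\<close> shows that these |x_j| are the radii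
  belonging to the coordinate.\<close>

lemma cut_pre_torus_actE:
  assumes "p \<in> cut_pre lam"
  obtains h where "h \<in> torus_prod 1" "p = torus_act h (cut_section ((cmod lam)\<^sup>2) g (cut_coord g p))"
proof -
  obtain x z where p: "p = (x, z)" by fastforce
  define h where "h = (\<chi> j. x $ j / (g $ j * complex_of_real (cmod (x $ j))))"
  define r where "r = (\<chi> j. cmod (x $ j))"
  have X: "(\<Prod>j\<in>UNIV. x $ j) = lam" using assms by (simp add: p cut_pre_def hypersurface_def)
  then have x: "x $ j \<noteq> 0" for j using lam by (metis UNIV_I finite prod_zero)
  have g': "cmod (g $ j) = 1" "g $ j \<noteq> 0" for j using torus_prodD[OF g] by auto
  have R: "(\<Prod>j\<in>UNIV. cmod (x $ j)) = cmod lam" using X by (simp add: prod_norm)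
  have h: "cmod (h $ j) = 1" for j using x by (simp add: h_def norm_divide norm_mult g')
  \<comment> \<open>The x_j multiply to lam, the g_j to its phase and the |x_j| to its modulus, so
    the quotient is 1.\<close>
  have "(\<Prod>j\<in>UNIV. h $ j) = lam / (lam / complex_of_real (cmod lam) * complex_of_real (cmod lam))"
    using X torus_prodD(3)[OF g]
    by (simp add: h_def prod_dividef prod.distrib R flip: of_real_prod)
  then have h1: "h \<in> torus_prod 1" using h lam by (simp add: torus_prod_def)
  have "cut_radii ((cmod lam)\<^sup>2) (cut_coord g p) = r"
  proof (rule cut_radii_eq)
    show "(r $ j)\<^sup>2 = (cmod (cut_coord g p $ j))\<^sup>2 + ((cmod (x $ i))\<^sup>2 - (cmod (z $ i))\<^sup>2)" for i j
    proof -
      have "(cmod (x $ j))\<^sup>2 - (cmod (z $ j))\<^sup>2 = (cmod (x $ i))\<^sup>2 - (cmod (z $ i))\<^sup>2"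
        using assms by (simp add: p cut_pre_def)
      moreover have "cmod (cut_coord g p $ j) = cmod (z $ j)"
        using x[of j] by (simp add: cut_coord_def p norm_mult norm_divide g')
      ultimately show ?thesis by (simp add: r_def)
    qed
  qed (use R x in \<open>simp_all add: r_def\<close>)
  then have "p = torus_act h (cut_section ((cmod lam)\<^sup>2) g (cut_coord g p))"
    using x g' by (simp add: p torus_act_def phi_C_def torus_inv_def cut_section_def phase_embed_def
        cut_coord_def h_def r_def vec_eq_iff)
  with h1 show ?thesis by (rule that)
qed

lemma cut_map_cut_coord: "p \<in> cut_pre lam \<Longrightarrow> cut_map lam g (cut_coord g p) = cut_q p"
  unfolding cut_map_def by (metis cut_pre_torus_actE cut_q_torus_act)

lemma cut_map_cut_chart: "m \<in> cut_space lam \<Longrightarrow> cut_map lam g (cut_chart g m) = m"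
  by (auto simp: cut_space_def cut_chart_cut_q cut_map_cut_coord)

lemma cut_map_cut_space: "cut_map lam g z \<in> cut_space lam"
  using cut_section_cut_pre by (auto simp: cut_map_def cut_space_def)

lemma bij_betw_cut_map: "bij_betw (cut_map lam g) UNIV (cut_space lam)"
  by (rule bij_betw_byWitness[where f' = "cut_chart g"])
    (auto simp: cut_chart_cut_map cut_map_cut_chart cut_map_cut_space)

lemma cut_chart_image: "cut_chart g ` cut_space lam = UNIV"
  by (metis cut_chart_cut_map cut_map_cut_space image_eqI UNIV_eq_I)

text \<open>The straight line through the coordinate of p is lifted and then translated by the h
  that carries the lift to p. The quotient map does not see h, so in the chart the curve is again
  that line.\<close>

lemma cut_chart_submersion:
  assumes "p \<in> cut_pre lam"
  shows "\<exists>\<gamma>. smooth_curve_at (cut_pre lam) p \<gamma> \<and> velocity (cut_chart g \<circ> cut_q \<circ> \<gamma>) = v"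
proof -
  obtain h where h: "h \<in> torus_prod 1"
    and p: "p = torus_act h (cut_section ((cmod lam)\<^sup>2) g (cut_coord g p))"
    using cut_pre_torus_actE[OF assms] .
  let ?f = "\<lambda>z. torus_act h (cut_section ((cmod lam)\<^sup>2) g z)"
  let ?\<gamma> = "?f \<circ> (\<lambda>t. cut_coord g p + t *\<^sub>R v)"
  have "smooth_on UNIV ?f"
    using smooth_on_cut_section[of "(cmod lam)\<^sup>2" g] lam unfolding smooth_on_def
    by (auto intro: Ck_on_bounded_linear[OF bounded_linear_torus_act])
  then have "smooth_curve_at (cut_pre lam) (?f (cut_coord g p)) ?\<gamma>"
    by (rule smooth_curve_at_compose[OF smooth_curve_at_line])
      (use torus_act_cut_pre[OF h cut_section_cut_pre] in auto)
  moreover have "cut_chart g \<circ> cut_q \<circ> ?\<gamma> = (\<lambda>t. cut_coord g p + t *\<^sub>R v)"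
    using cut_chart_cut_map by (simp add: fun_eq_iff cut_q_torus_act[OF h] cut_map_def)
  ultimately show ?thesis using p velocity_line by metis
qed

lemma cut_chart_cut_atlas: "(cut_space lam, cut_chart g) \<in> cut_atlas lam"
proof -
  have S: "cut_pre lam \<inter> cut_q -` cut_space lam = cut_pre lam"
    by (auto simp: cut_space_def)
  have nz: "fst p $ j \<noteq> 0" if "p \<in> cut_pre lam" for p :: "(complex^'n) \<times> (complex^'n)" and j
  proof
    assume "fst p $ j = 0"
    then have "(\<Prod>j\<in>UNIV. fst p $ j) = 0" by (intro prod_zero) auto
    then show False using that lam by (auto simp: cut_pre_def hypersurface_def)
  qed
  \<comment> \<open>The nonvanishing locus is an open neighbourhood of the level set, on which
    \<open>cut_coord\<close> is the required smooth extension of the chart composed with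
    \<open>cut_q\<close>.\<close>
  have "open {p :: (complex^'n) \<times> (complex^'n). \<forall>j. fst p $ j \<noteq> 0}"
    unfolding Collect_all_eq by (intro open_INT ballI open_Collect_neq continuous_intros) auto
  then have "smooth_on_subset (cut_pre lam) (cut_chart g \<circ> cut_q)"
    using nz unfolding smooth_on_subset_def
    by (intro ballI exI[of _ "{p. \<forall>j. fst p $ j \<noteq> 0}"] exI[of _ "cut_coord g"])
      (simp add: smooth_on_cut_coord cut_chart_cut_q)
  moreover have "inj_on (cut_chart g) (cut_space lam)"
    by (rule inj_on_inverseI[of _ "cut_map lam g"]) (rule cut_map_cut_chart)
  ultimately show ?thesis
    using cut_chart_submersion
    by (simp add: cut_atlas_def quotient_atlas_def S cut_chart_image) (simp add: cut_space_def)
qed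

section \<open>Diffeomorphism property and pullback of the form\<close>

lemma smooth_map_cut_map: "smooth_map UNIV (cut_atlas lam) (cut_map lam g)"
  unfolding smooth_map_def
proof (intro ballI bexI[OF _ cut_chart_cut_atlas], clarify, intro exI conjI)
  \<comment> \<open>In its own global chart the map is the identity.\<close>
  show "smooth_on_subset (UNIV \<inter> UNIV) (cut_chart g \<circ> cut_map lam g)"
    unfolding smooth_on_subset_def
    by (intro ballI exI[of _ UNIV] exI[of _ "\<lambda>z. z"])
      (simp add: cut_chart_cut_map smooth_on_def Ck_on_ident)
qed (auto simp: cut_map_cut_space)

lemma diffeo_onto_cut_map: "diffeo_onto (cut_space lam) (cut_atlas lam) (cut_map lam g)"
proof -
  have inv: "inv_into (cut_space lam) (cut_chart g) y = cut_map lam g y" for y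
    by (rule inv_into_f_eq) (auto intro: inj_on_inverseI[of _ "cut_map lam g"]
        simp: cut_map_cut_chart cut_map_cut_space cut_chart_cut_map)
  have "inv_into UNIV (cut_map lam g) (cut_map lam g y) = y" for y
    using bij_betw_cut_map by (intro inv_into_f_f) (auto simp: bij_betw_def)
  then have "inv_into UNIV (cut_map lam g) \<circ> inv_into (cut_space lam) (cut_chart g) = (\<lambda>y. y)"
    by (simp add: fun_eq_iff inv)
  then have "smooth_on (cut_chart g ` cut_space lam)
      (inv_into UNIV (cut_map lam g) \<circ> inv_into (cut_space lam) (cut_chart g))"
    by (simp add: smooth_on_def cut_chart_image Ck_on_ident)
  then show ?thesis
    unfolding diffeo_onto_def using bij_betw_cut_map smooth_map_cut_map cut_chart_cut_atlas by blast
qed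

text \<open>The hypothesis on \<open>cut_q\<close> covers all charts and all smooth curves in the
  level set. Lifting curves of the model space produces such curves with the same image in the
  quotient, so only the velocities of the lifts have to be computed.\<close>

lemma pulls_back_to_cut_map:
  assumes "pulls_back_to (cut_pre lam) cut_q (cut_atlas lam) \<Omega> omega_CC"
  shows "pulls_back_to UNIV (cut_map lam g) (cut_atlas lam) \<Omega> omega_C"
  unfolding pulls_back_to_def
proof (intro ballI, clarify)
  fix z :: "complex^'n" and U \<phi> \<gamma> \<delta>
  assume U: "(U, \<phi>) \<in> cut_atlas lam" "cut_map lam g z \<in> U"
    and \<gamma>: "smooth_curve_at UNIV z \<gamma>" and \<delta>: "smooth_curve_at UNIV z \<delta>"
  let ?w = "(cmod lam)\<^sup>2"
  let ?s = "cut_section ?w g"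
  have "Ck_on (Suc 0) (cut_radii ?w) (UNIV :: (complex^'n) set)"
    using Ck_on_cut_radii[of ?w "Suc 0"] lam by simp
  then obtain D where D: "(cut_radii ?w has_derivative D) (at z)"
    using Ck_on_Suc_has_derivative by blast
  have "(?s has_derivative (\<lambda>v. (phase_embed g (D v), v))) (at z)"
    unfolding cut_section_def
    by (intro has_derivative_Pair bounded_linear.has_derivative[OF bounded_linear_phase_embed] D
        has_derivative_ident)
  then have vel: "velocity (?s \<circ> \<beta>) = (phase_embed g (D (velocity \<beta>)), velocity \<beta>)"
    if "smooth_curve_at UNIV z \<beta>" for \<beta>
    using velocity_compose[OF that] by blast
  have "smooth_curve_at (cut_pre lam) (?s z) (?s \<circ> \<beta>)" if "smooth_curve_at UNIV z \<beta>" for \<beta>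
    by (rule smooth_curve_at_compose[OF that])
      (use lam cut_section_cut_pre in \<open>auto intro!: smooth_on_cut_section\<close>)
  then have "\<Omega> (U, \<phi>) (\<phi> (cut_q (?s z)))
      (velocity (\<phi> \<circ> cut_q \<circ> (?s \<circ> \<gamma>))) (velocity (\<phi> \<circ> cut_q \<circ> (?s \<circ> \<delta>)))
      = omega_CC (velocity (?s \<circ> \<gamma>)) (velocity (?s \<circ> \<delta>))"
    using assms U \<gamma> \<delta> cut_section_cut_pre unfolding pulls_back_to_def cut_map_def by blast
  moreover have "\<phi> \<circ> cut_q \<circ> (?s \<circ> \<beta>) = \<phi> \<circ> cut_map lam g \<circ> \<beta>" for \<beta> :: "real \<Rightarrow> complex^'n"
    by (simp add: fun_eq_iff cut_map_def)
  ultimately show "\<Omega> (U, \<phi>) (\<phi> (cut_map lam g z))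
      (velocity (\<phi> \<circ> cut_map lam g \<circ> \<gamma>)) (velocity (\<phi> \<circ> cut_map lam g \<circ> \<delta>))
      = omega_C (velocity \<gamma>) (velocity \<delta>)"
    by (simp add: vel[OF \<gamma>] vel[OF \<delta>] omega_CC_def omega_C_phase_embed flip: cut_map_def)
qed

section \<open>Compatibility with the projection, the moment map, the action and F\<close>

lemma pi_Z_cut_map: "pi_Z (cut_map lam g z) = (\<Prod>j\<in>UNIV. z $ j)"
  by (simp add: cut_map_def cut_section_def pi_Z_cut_q)

text \<open>Passing from z to the first component of the lift adds t / 2 to every entry of the
  moment map, a diagonal vector that \<open>r_bullet\<close> kills.\<close>

lemma mu_Z_cut_map: "mu_Z (cut_map lam g z) = r_bullet (mu_C z)"
proof -
  let ?T = "prod_shift ((cmod lam)\<^sup>2) (\<chi> j. (cmod (z $ j))\<^sup>2)"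
  have "mu_C (phase_embed g (cut_radii ((cmod lam)\<^sup>2) z)) = mu_C z + (?T / 2) *\<^sub>R (\<chi> j. 1)"
    using torus_prodD(1)[OF g] cut_radii_power2[of "(cmod lam)\<^sup>2" z] lam
    by (simp add: mu_C_def phase_embed_def vec_eq_iff norm_mult add_divide_distrib)
  moreover have "r_bullet (u + s *\<^sub>R (\<chi> j. 1)) = r_bullet u" for u :: "real^'n" and s
  proof -
    have "u + t *\<^sub>R (\<chi> j. 1) = (u + s *\<^sub>R (\<chi> j. 1)) + (t - s) *\<^sub>R (\<chi> j. 1)" for t
      by (simp add: vec_eq_iff algebra_simps)
    moreover have "(u + s *\<^sub>R (\<chi> j. 1)) + t *\<^sub>R (\<chi> j. 1) = u + (s + t) *\<^sub>R (\<chi> j. 1)" for t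
      by (simp add: vec_eq_iff algebra_simps)
    ultimately show ?thesis unfolding r_bullet_def by blast
  qed
  ultimately show ?thesis by (simp add: cut_map_def cut_section_def mu_Z_cut_q)
qed

text \<open>The radii depend only on the moduli of z, so h leaves them unchanged. Changing the
  representative by h moves the rotation from the second component to the first.\<close>

lemma phi_Z_cut_map:
  assumes "h \<in> torus_prod 1"
  shows "phi_Z h (cut_map lam g z) = cut_map lam g (phi_C h z)"
proof -
  let ?r = "cut_radii ((cmod lam)\<^sup>2)"
  have "?r (phi_C h z) = ?r z"
    using torus_prodD(1)[OF assms] by (simp add: cut_radii_def phi_C_def norm_mult)
  moreover have "torus_act h (phase_embed g (?r z), phi_C h z) = (phi_C h (phase_embed g (?r z)), z)"
    using torus_prodD(2)[OF assms] by (simp add: torus_act_def phi_C_def torus_inv_def vec_eq_iff)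
  ultimately show ?thesis
    using cut_q_torus_act[OF assms, of "(phase_embed g (?r z), phi_C h z)"]
    by (simp add: cut_map_def cut_section_def phi_Z_cut_q)
qed

text \<open>For x in the hypersurface the solution is rho = |x_i|^2, which turns the factors into
  |x_j|^2. Thus F gives the class of (x, g |x|), while the lift over x is (g |x|, x); both lie in
  one orbit because the coordinate of the former pair is x.\<close>

lemma cut_F_eq_cut_map:
  assumes "x \<in> hypersurface lam"
  shows "cut_F i (cmod lam) g x = cut_map lam g x"
proof -
  let ?a = "\<lambda>j. (cmod (x $ j))\<^sup>2 - (cmod (x $ i))\<^sup>2"
  have X: "(\<Prod>j\<in>UNIV. x $ j) = lam" using assms by (simp add: hypersurface_def)
  then have x: "0 < cmod (x $ j)" for j
    using lam by (metis UNIV_I finite prod_zero zero_less_norm_iff)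
  have R: "(\<Prod>j\<in>UNIV. cmod (x $ j)) = cmod lam" using X by (simp add: prod_norm)
  have "cut_rho i (cmod lam) x = (cmod (x $ i))\<^sup>2"
    unfolding cut_rho_def
  proof (rule the_equality)
    show "(\<Prod>j\<in>UNIV. ?a j + (cmod (x $ i))\<^sup>2) = (cmod lam)\<^sup>2 \<and>
        Max (range (\<lambda>j. (cmod (x $ i))\<^sup>2 - (cmod (x $ j))\<^sup>2)) \<le> (cmod (x $ i))\<^sup>2"
      using R by (simp flip: prod_power_distrib)
  next
    fix \<rho>
    assume \<rho>: "(\<Prod>j\<in>UNIV. ?a j + \<rho>) = (cmod lam)\<^sup>2 \<and>
        Max (range (\<lambda>j. (cmod (x $ i))\<^sup>2 - (cmod (x $ j))\<^sup>2)) \<le> \<rho>"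
    \<comment> \<open>The lower bound on rho gives nonnegative factors only; the nonzero product
      makes them positive, as \<open>prod_add_cancel\<close> demands.\<close>
    then have "0 \<le> ?a j + \<rho>" for j by (simp add: algebra_simps)
    moreover have "?a j + \<rho> \<noteq> 0" for j
    proof
      assume "?a j + \<rho> = 0"
      then have "(\<Prod>j\<in>UNIV. ?a j + \<rho>) = 0" by (intro prod_zero) auto
      then show False using \<rho> lam by simp
    qed
    ultimately have pos: "0 < ?a j + \<rho>" for j by (simp add: order_less_le)
    have "(\<Prod>j\<in>UNIV. ?a j + \<rho>) = (\<Prod>j\<in>UNIV. ?a j + (cmod (x $ i))\<^sup>2)"
      using \<rho> R by (simp flip: prod_power_distrib)
    then show "\<rho> = (cmod (x $ i))\<^sup>2"
      by (rule prod_add_cancel[OF finite UNIV_not_empty, rotated 2])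
        (use pos x in \<open>simp_all add: order_less_imp_not_eq2\<close>)
  qed
  then have "cut_F i (cmod lam) g x = cut_q (x, phase_embed g (\<chi> j. cmod (x $ j)))"
    by (simp add: cut_F_def phase_embed_def)
  also have "\<dots> = cut_map lam g (cut_coord g (x, phase_embed g (\<chi> j. cmod (x $ j))))"
    by (rule cut_map_cut_coord[symmetric])
      (use assms torus_prodD(1)[OF g] in \<open>simp add: cut_pre_def phase_embed_def norm_mult\<close>)
  also have "cut_coord g (x, phase_embed g (\<chi> j. cmod (x $ j))) = x"
    using x torus_prodD(2)[OF g] by (simp add: cut_coord_def phase_embed_def vec_eq_iff)
  finally show ?thesis .
qed

end

section \<open>Joint smoothness and the divisors\<close>

lemma smooth_map_cut_map_joint:
  fixes lam :: complex
  assumes lam: "lam \<noteq> 0"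
  shows "smooth_map (torus_prod (lam / complex_of_real (cmod lam)) \<times> (UNIV :: (complex^'n) set))
    (cut_atlas lam) (\<lambda>(g, z). cut_map lam g z)"
proof -
  let ?T = "torus_prod (lam / complex_of_real (cmod lam)) :: (complex^'n) set"
  let ?F = "\<lambda>(g, z). cut_map lam g (z :: complex^'n)"
  have "\<exists>(U, \<phi>)\<in>cut_atlas lam. \<exists>W. open W \<and> p \<in> W \<and> ?F ` ((?T \<times> UNIV) \<inter> W) \<subseteq> U \<and>
      smooth_on_subset ((?T \<times> UNIV) \<inter> W) (\<phi> \<circ> ?F)"
    if p: "p \<in> ?T \<times> UNIV" for p
  proof -
    obtain g0 where g0: "g0 \<in> ?T" using p by auto
    \<comment> \<open>The expression of the map in the chart of the fixed g0; it is polynomial in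
      (g, z), hence extends smoothly from the coset to the whole ambient space.\<close>
    let ?G = "\<lambda>p :: (complex^'n) \<times> (complex^'n). \<chi> j. snd p $ j * (fst p $ j * inverse (g0 $ j))"
    have "cut_chart g0 (cut_map lam g z) = ?G (g, z)" if "g \<in> ?T" for g z
      using that lam cut_coord_cut_section[of "(cmod lam)\<^sup>2" g _ g0 z]
      by (simp add: cut_map_def cut_chart_cut_q)
    moreover have "Ck_on k ?G UNIV" for k
      by (intro Ck_on_vec_lambda Ck_on_mult Ck_on_vec_nth Ck_on_const Ck_on_ident open_UNIV
          Ck_on_bounded_linear[OF bounded_linear_fst] Ck_on_bounded_linear[OF bounded_linear_snd])
    ultimately have "smooth_on_subset (?T \<times> UNIV) (cut_chart g0 \<circ> ?F)"
      unfolding smooth_on_subset_def smooth_on_def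
      by (intro ballI exI[of _ UNIV] exI[of _ ?G]) auto
    moreover have "?F ` (?T \<times> UNIV) \<subseteq> cut_space lam"
      using cut_map_cut_space[OF lam] by auto
    ultimately show ?thesis
      by (intro bexI[OF _ cut_chart_cut_atlas[OF lam g0]]) (auto intro!: exI[of _ UNIV])
  qed
  then show ?thesis unfolding smooth_map_def by blast
qed

lemma cut_map_image_cut_divisor:
  fixes lam :: complex and i :: "'n::finite"
  assumes lam: "lam \<noteq> 0"
  defines "T \<equiv> torus_prod (lam / complex_of_real (cmod lam))"
  shows "(\<lambda>(g, z). cut_map lam g z) ` (T \<times> {z. z $ i = 0}) = cut_divisor lam i"
proof (intro equalityI subsetI)
  fix m assume "m \<in> (\<lambda>(g, z). cut_map lam g z) ` (T \<times> {z. z $ i = 0})"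
  then obtain g z where gz: "g \<in> T" "z $ i = 0" "m = cut_map lam g z" by auto
  moreover have "cut_section ((cmod lam)\<^sup>2) g z \<in> cut_pre lam"
    using cut_section_cut_pre[OF lam] gz(1) unfolding T_def by blast
  ultimately show "m \<in> cut_divisor lam i"
    unfolding cut_divisor_def cut_map_def cut_section_def by blast
next
  fix m assume "m \<in> cut_divisor lam i"
  then obtain x z where m: "m = cut_q (x, z)" "(x, z) \<in> cut_pre lam" "z $ i = 0"
    unfolding cut_divisor_def by blast
  \<comment> \<open>Any element of the coset would do to define a coordinate; this one puts the
    whole phase of lam into slot i.\<close>
  define g :: "complex^'n" where "g = (\<chi> j. if j = i then lam / complex_of_real (cmod lam) else 1)"
  have "g \<in> T" using lam by (simp add: g_def T_def torus_prod_def norm_divide)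
  moreover have "cut_map lam g (cut_coord g (x, z)) = m"
    using cut_map_cut_coord[OF lam] m \<open>g \<in> T\<close> unfolding T_def by blast
  moreover have "cut_coord g (x, z) $ i = 0" by (simp add: cut_coord_def m)
  ultimately show "m \<in> (\<lambda>(g, z). cut_map lam g z) ` (T \<times> {z. z $ i = 0})"
    by (intro image_eqI[of _ _ "(g, cut_coord g (x, z))"]) auto
qed

theorem proposition6p4:
  fixes lam :: complex
    and \<omega>\<^sub>Z :: "(((complex^'n) \<times> (complex^'n)) set, complex^'n) two_form"
  assumes "lam \<noteq> 0"
    and "is_cut_symplectic_form lam \<omega>\<^sub>Z"
  shows "\<exists>F :: complex^'n \<Rightarrow> complex^'n \<Rightarrow> ((complex^'n) \<times> (complex^'n)) set.
    let S\<^sub>c = torus_prod (lam / complex_of_real (cmod lam)) in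
      smooth_map (S\<^sub>c \<times> UNIV) (cut_atlas lam) (\<lambda>(g, z). F g z) \<and>
      (\<forall>g\<in>S\<^sub>c. symplectomorphism_onto (cut_space lam) (cut_atlas lam) \<omega>\<^sub>Z omega_C (F g)) \<and>
      (\<forall>i. (\<lambda>(g, z). F g z) ` (S\<^sub>c \<times> {z. z $ i = 0}) = cut_divisor lam i) \<and>
      (\<forall>g\<in>S\<^sub>c. \<forall>z. pi_Z (F g z) = (\<Prod>j\<in>UNIV. z $ j)) \<and>
      (\<forall>i. \<forall>g\<in>S\<^sub>c. \<forall>x\<in>hypersurface lam. F g x = cut_F i (cmod lam) g x) \<and>
      (\<forall>g\<in>S\<^sub>c. \<forall>z. \<forall>g'\<in>torus_prod 1. phi_Z g' (F g z) = F g (phi_C g' z)) \<and>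
      (\<forall>g\<in>S\<^sub>c. \<forall>z. mu_Z (F g z) = r_bullet (mu_C z))"
proof -
  have "pulls_back_to (cut_pre lam) cut_q (cut_atlas lam) \<omega>\<^sub>Z omega_CC"
    using assms(2) by (simp add: is_cut_symplectic_form_def)
  note facts = smooth_map_cut_map_joint[OF assms(1)] diffeo_onto_cut_map[OF assms(1)]
    pulls_back_to_cut_map[OF assms(1) _ this] cut_map_image_cut_divisor[OF assms(1)]
    pi_Z_cut_map[OF assms(1)] cut_F_eq_cut_map[OF assms(1)] phi_Z_cut_map[OF assms(1)]
    mu_Z_cut_map[OF assms(1)]
  show ?thesis
    unfolding Let_def symplectomorphism_onto_def
    by (rule exI[of _ "cut_map lam"]) (simp add: facts)
qed

end
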